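(* Let $p$ be a prime and $N\ge 2$ an integer, written $N=\sum_{i=1}^hN_ip^{s_i}$ with $1\le N_i\le p-1$ for all $i$ and $0\le s_1<s_2<\dots<s_h$. Let $1\le r<N$. Then $r\in I_p(N)$ if and only if $r$ is of one of the following forms: (1) $r=dp^s$ with $0\le s<s_1$ and $1\le d\le p-1$; (2) $r=dp^{s_1}$ with $1\le d\le N_1-1$; (3) $r=\sum_{i=1}^jN_ip^{s_i}$ with $1\le j<h$; (4) $r=\sum_{i=1}^jN_ip^{s_i}+dp^{s_j}$ with $1\le j<h$ and $N_j+1\le d\le p-1$; (5) $r=\sum_{i=1}^jN_ip^{s_i}+dp^{s}$ with $1\le j<h$, $s_j<s<s_{j+1}$ and $1\le d\le p-1$; (6) $r=\sum_{i=1}^jN_ip^{s_i}+dp^{s_{j+1}}$ with $1\le j<h$ and $1\le d\le N_{j+1}-1$.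
   Context: For an integer $r$ with $0\le r\le N-1$, set $R=N-r$ and let $R=\sum_{i=f}^kR_ip^i$ be its $p$-adic expansion ($0\le R_i\le p-1$) with $R_f\ne 0$; thus $f$ and $R_f$ depend on $r$. $I_p(N)$ is the set of all integers $r$ with $0\le r\le N-1$ and $r<2(p-R_f)p^f$. (For $N=m+1$, this set consists of those $r$ for which the Weyl module $\Delta(\omega_r)$ of $\mathrm{Sp}(2m)$ in characteristic $p$ is simple.) *)

theory Defs
  imports "HOL-Computational_Algebra.Primes"
begin

text \<open>
  The expansion starts at its lowest nonzero digit \<open>c f\<close>; leading zeros (at the top index \<open>k\<close>)
  are not excluded, so only \<open>f\<close> and the digits, but not \<open>k\<close>, are determined by \<open>R\<close>
  (see \<open>padic_expansion_exists\<close> and \<open>padic_expansion_unique\<close>).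
\<close>

definition padic_expansion :: "nat \<Rightarrow> nat \<Rightarrow> nat \<Rightarrow> nat \<Rightarrow> (nat \<Rightarrow> nat) \<Rightarrow> bool" where
  "padic_expansion p R f k c \<longleftrightarrow>
     f \<le> k \<and> (\<forall>i\<in>{f..k}. c i \<le> p - 1) \<and> c f \<noteq> 0 \<and> R = (\<Sum>i=f..k. c i * p ^ i)"

text \<open>
  In \<open>p - c f\<close> the truncated subtraction is exact, since \<open>c f \<le> p - 1\<close>.  The existential
  quantifier is harmless because \<open>f\<close> and \<open>c f\<close> exist and are unique for \<open>N - r > 0\<close>.
\<close>

definition I_set :: "nat \<Rightarrow> nat \<Rightarrow> nat set" where
  "I_set p N = {r. r < N \<and>
     (\<exists>f k c. padic_expansion p (N - r) f k c \<and> r < 2 * (p - c f) * p ^ f)}"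

lemma padic_expansion_exists:
  fixes p R :: nat
  assumes "prime p" and "R > 0"
  shows "\<exists>f k c. padic_expansion p R f k c"
  using \<open>R > 0\<close>
proof (induction R rule: less_induct)
  case (less R)
  have p: "p > 1" using assms(1) by (rule prime_gt_1_nat)
  show ?case
  proof (cases "R div p = 0")
    case True
    then have "R < p" using p by (simp add: div_eq_0_iff)
    then have "padic_expansion p R 0 0 (\<lambda>_. R)"
      using less.prems by (auto simp: padic_expansion_def)
    then show ?thesis by blast
  next
    case False
    have "R div p < R" using p less.prems by simp
    with less.IH False obtain f k c where e: "padic_expansion p (R div p) f k c" by blast
    define c' where "c' = (\<lambda>i. if i = 0 then R mod p else if i - 1 < f then 0 else c (i - 1))"
    have fk: "f \<le> k" and cb: "\<forall>i\<in>{f..k}. c i \<le> p - 1" and cf: "c f \<noteq> 0"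
      and eq: "R div p = (\<Sum>i=f..k. c i * p ^ i)"
      using e by (auto simp: padic_expansion_def)
    have b: "c' i \<le> p - 1" if "i \<le> Suc k" for i
    proof -
      have "R mod p \<le> p - 1" using p mod_less_divisor[of p R] by linarith
      then show ?thesis using cb that by (auto simp: c'_def)
    qed
    have top: "(\<Sum>i=Suc f..Suc k. c' i * p ^ i) = p * (R div p)"
      unfolding sum.shift_bounds_cl_Suc_ivl eq sum_distrib_left
      by (rule sum.cong) (auto simp: c'_def)
    show ?thesis
    proof (cases "R mod p = 0")
      case True
      then have "R = (\<Sum>i=Suc f..Suc k. c' i * p ^ i)" unfolding top by auto
      moreover have "c' (Suc f) \<noteq> 0" using cf by (simp add: c'_def)
      ultimately have "padic_expansion p R (Suc f) (Suc k) c'"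
        unfolding padic_expansion_def using fk b by simp
      then show ?thesis by blast
    next
      case False
      have "(\<Sum>i=0..Suc k. c' i * p ^ i) = c' 0 + (\<Sum>i=Suc 0..Suc k. c' i * p ^ i)"
        by (subst sum.atLeast_Suc_atMost) auto
      also have "(\<Sum>i=Suc 0..Suc k. c' i * p ^ i) = (\<Sum>i=Suc f..Suc k. c' i * p ^ i)"
        by (rule sum.mono_neutral_right) (auto simp: c'_def)
      also have "c' 0 + \<dots> = R" unfolding top by (simp add: c'_def)
      finally have "R = (\<Sum>i=0..Suc k. c' i * p ^ i)" ..
      moreover have "c' 0 \<noteq> 0" using False by (simp add: c'_def)
      ultimately have "padic_expansion p R 0 (Suc k) c'"
        unfolding padic_expansion_def using b by simp
      then show ?thesis by blast
    qed
  qed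
qed

lemma padic_expansion_lowest:
  fixes p R :: nat
  assumes "prime p" and "padic_expansion p R f k c"
  shows "f = multiplicity p R" and "c f = R div p ^ f mod p"
proof -
  have p: "p > 1" using assms(1) by (rule prime_gt_1_nat)
  have fk: "f \<le> k" and cf: "c f \<noteq> 0" and "c f \<le> p - 1"
    and eq: "R = (\<Sum>i=f..k. c i * p ^ i)"
    using assms(2) by (auto simp: padic_expansion_def)
  then have lt: "c f < p" using p by linarith
  have "p ^ Suc f dvd (\<Sum>i=Suc f..k. c i * p ^ i)"
    by (rule dvd_sum) (meson atLeastAtMost_iff dvd_mult le_imp_power_dvd)
  then obtain M where "(\<Sum>i=Suc f..k. c i * p ^ i) = p ^ Suc f * M" ..
  with eq fk have R: "R = p ^ f * (c f + p * M)"
    by (simp add: sum.atLeast_Suc_atMost algebra_simps)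
  have nd: "\<not> p dvd c f + p * M"
    using lt cf by (simp add: dvd_add_left_iff nat_dvd_not_less)
  show "f = multiplicity p R"
    by (rule multiplicity_eqI[symmetric]) (use R nd p in \<open>auto simp: mult.commute[of p]\<close>)
  show "c f = R div p ^ f mod p" using R p lt by simp
qed

lemma padic_expansion_unique:
  fixes p R :: nat
  assumes "prime p" and "padic_expansion p R f k c" and "padic_expansion p R f' k' c'"
  shows "f = f'" and "c f = c' f'"
  using padic_expansion_lowest[OF assms(1,2)] padic_expansion_lowest[OF assms(1,3)] by simp_all

end

theory Submission
  imports Defs
begin

text \<open>
  Write \<open>N - r = p ^ f * (a + p * M)\<close> with \<open>0 < a < p\<close>.  Then \<open>N\<close> and \<open>r\<close> agree modulo
  \<open>p ^ f\<close>, so with \<open>q = r div p ^ f\<close> the condition \<open>r < 2 * (p - a) * p ^ f\<close> depends on \<open>q\<close>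
  alone and reads \<open>q < 2 * (p - a)\<close>.  Let \<open>n\<close> be the digit of \<open>N\<close> at position \<open>f\<close>, so that
  \<open>n\<close> is congruent to \<open>q + a\<close> modulo \<open>p\<close>.  If \<open>q + a < p\<close> this means \<open>q < n\<close>; otherwise
  \<open>q = n + d\<close> with \<open>d = p - a\<close>, and the condition becomes \<open>n < d\<close>.  The six forms arise by
  locating \<open>f\<close> among the exponents \<open>s i\<close>.
\<close>

section \<open>Membership in terms of a factorization of \<open>N - r\<close>, then of the digits of
  \<open>N\<close>\<close>

text \<open>Only the lowest nonzero digit of \<open>N - r\<close> enters the condition, so all
  higher digits can be packed into \<open>M\<close>. Since \<open>0 < a < p\<close>, the prime does
  not divide \<open>a + p * M\<close>; hence \<open>f\<close> must be the multiplicity of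
  \<open>p\<close> in \<open>N - r\<close> and \<open>a\<close> the digit there. Adding
  \<open>r\<close> on the right avoids truncated subtraction.\<close>

lemma I_set_iff_factorization:
  fixes p N r :: nat
  assumes "prime p" and "r < N"
  shows "r \<in> I_set p N \<longleftrightarrow>
    (\<exists>f a M. N = r + p ^ f * (a + p * M) \<and> 0 < a \<and> a < p \<and> r < 2 * (p - a) * p ^ f)"
proof
  assume "r \<in> I_set p N"
  then obtain f k c where e: "padic_expansion p (N - r) f k c" and lt: "r < 2 * (p - c f) * p ^ f"
    by (auto simp: I_set_def)
  have p: "p > 1" using assms(1) by (rule prime_gt_1_nat)
  let ?R = "N - r"
  note lo = padic_expansion_lowest[OF assms(1) e]
  have "c f > 0" "c f < p" using e p by (auto simp: padic_expansion_def lo(2))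
  moreover have "p ^ f dvd ?R" unfolding lo(1) by (rule multiplicity_dvd)
  then have "?R = p ^ f * (?R div p ^ f)" by simp
  then have "?R = p ^ f * (c f + p * (?R div p ^ f div p))"
    unfolding lo(2) by (simp only: mod_mult_div_eq)
  then have "N = r + p ^ f * (c f + p * (?R div p ^ f div p))" using assms(2) by linarith
  ultimately show "\<exists>f a M. N = r + p ^ f * (a + p * M) \<and> 0 < a \<and> a < p \<and> r < 2 * (p - a) * p ^ f"
    using lt by blast
next
  assume "\<exists>f a M. N = r + p ^ f * (a + p * M) \<and> 0 < a \<and> a < p \<and> r < 2 * (p - a) * p ^ f"
  then obtain f a M where N: "N = r + p ^ f * (a + p * M)" and a: "0 < a" "a < p"
    and lt: "r < 2 * (p - a) * p ^ f" by blast
  have R: "N - r = p ^ f * (a + p * M)" using N by simp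
  obtain g k c where e: "padic_expansion p (N - r) g k c"
    using padic_expansion_exists[OF assms(1), of "N - r"] assms(2) by auto
  note lo = padic_expansion_lowest[OF assms(1) e]
  have "\<not> p dvd a + p * M" using a by (simp add: dvd_add_left_iff nat_dvd_not_less)
  then have "multiplicity p (N - r) = f"
    by (intro multiplicity_eqI) (use R a in \<open>auto simp: mult.commute[of p]\<close>)
  then have "g = f" using lo(1) by simp
  moreover have "c g = a" using a lo(2) by (simp add: \<open>g = f\<close> R)
  ultimately show "r \<in> I_set p N" using e lt assms(2) by (auto simp: I_set_def)
qed

lemma mod_power_Suc:
  fixes p N :: nat
  shows "N mod p ^ Suc f = N mod p ^ f + (N div p ^ f mod p) * p ^ f"
  by (simp add: mod_mult2_eq mult.commute[of p])

text \<open>The two alternatives are addition of \<open>a\<close> to \<open>q\<close> at position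
  \<open>f\<close> without and with a carry. In the second, \<open>d\<close> is
  \<open>p - a\<close>, and the digit of \<open>N\<close> at \<open>f\<close> is absorbed into
  \<open>N mod p ^ Suc f\<close>, so that both describe \<open>r\<close> through truncations of
  \<open>N\<close>.\<close>

lemma I_set_iff_digit:
  fixes p N r :: nat
  assumes "prime p" and "r < N"
  shows "r \<in> I_set p N \<longleftrightarrow>
    (\<exists>f. (\<exists>q < N div p ^ f mod p. r = N mod p ^ f + q * p ^ f) \<or>
         (\<exists>d. N div p ^ f mod p < d \<and> d < p \<and> r = N mod p ^ Suc f + d * p ^ f))"
    (is "_ \<longleftrightarrow> (\<exists>f. ?A f \<or> ?B f)")
proof
  assume "r \<in> I_set p N"
  then obtain f a M where N: "N = r + p ^ f * (a + p * M)" and a: "0 < a" "a < p"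
    and lt: "r < 2 * (p - a) * p ^ f" using I_set_iff_factorization[OF assms] by blast
  define q where "q = r div p ^ f"
  have pf: "p ^ f > 0" using a by simp
  have u: "N mod p ^ f = r mod p ^ f" unfolding N by simp
  have r: "r = N mod p ^ f + q * p ^ f" unfolding u q_def by (rule mod_div_mult_eq[symmetric])
  have q: "q < 2 * (p - a)" using lt unfolding q_def by (rule less_mult_imp_div_less)
  have "N div p ^ f = q + a + p * M" unfolding N q_def using pf by simp
  then have n: "N div p ^ f mod p = (q + a) mod p" by simp
  show "\<exists>f. ?A f \<or> ?B f"
  proof (cases "q + a < p")
    case True
    then have "?A f" using r n a by (intro exI[of _ q]) simp
    then show ?thesis by blast
  next
    case False
    \<comment> \<open>The bound on \<open>q\<close> gives \<open>q + a < 2 * p - a\<close>, so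
      subtracting \<open>p\<close> once reduces \<open>q + a\<close> modulo
      \<open>p\<close>.\<close>
    then have n': "N div p ^ f mod p = q + a - p" using n q a by (simp add: le_mod_geq)
    have "r = N mod p ^ f + ((q + a - p) + (p - a)) * p ^ f" using r False a by simp
    then have "r = N mod p ^ Suc f + (p - a) * p ^ f"
      unfolding mod_power_Suc n' by (simp only: add_mult_distrib add.assoc)
    moreover have "N div p ^ f mod p < p - a" "p - a < p" using q n' a False by linarith+
    ultimately have "?B f" by blast
    then show ?thesis by blast
  qed
next
  assume "\<exists>f. ?A f \<or> ?B f"
  then obtain f where f: "?A f \<or> ?B f" by blast
  define u n M where "u = N mod p ^ f" and "n = N div p ^ f mod p" and "M = N div p ^ f div p"
  have p: "p > 1" using assms(1) by (rule prime_gt_1_nat)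
  have n: "n < p" and u: "u < p ^ f" using p by (simp_all add: n_def u_def)
  have N: "N = u + (n + p * M) * p ^ f"
    unfolding u_def n_def M_def by (simp only: mod_mult_div_eq mod_div_mult_eq)
  have less: "u + q * p ^ f < c * p ^ f" if "q < c" for q c
  proof -
    have "u + q * p ^ f < Suc q * p ^ f" using u by simp
    also have "\<dots> \<le> c * p ^ f" using that by (intro mult_right_mono) auto
    finally show ?thesis .
  qed
  from f show "r \<in> I_set p N"
  proof
    assume "?A f"
    then obtain q where q: "q < n" and r: "r = u + q * p ^ f" by (auto simp: n_def u_def)
    obtain a where a: "n = q + a" "a > 0" using q by (metis less_imp_add_positive)
    have "N = r + p ^ f * (a + p * M)" unfolding N r a(1) by (simp add: algebra_simps)
    moreover have "r < 2 * (p - a) * p ^ f" unfolding r by (rule less) (use a n in linarith)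
    ultimately show ?thesis
      using I_set_iff_factorization[OF assms] a n by (metis le_add2 le_less_trans)
  next
    assume "?B f"
    then obtain d where d: "n < d" "d < p" and r: "r = u + (n + d) * p ^ f"
      unfolding mod_power_Suc by (auto simp: n_def u_def algebra_simps)
    \<comment> \<open>Because \<open>r < N\<close>, the part \<open>M\<close> of \<open>N\<close>
      above position \<open>f\<close> is nonzero. One unit is borrowed from it and split as
      \<open>p = d + a\<close>: the \<open>d\<close> goes into \<open>r\<close>, and
      \<open>a\<close> becomes the lowest nonzero digit of \<open>N - r\<close>.\<close>
    have "(n + d) * p ^ f < (n + p * M) * p ^ f" using assms(2) unfolding N r by linarith
    then have "M \<noteq> 0" by (cases M) auto
    then obtain M' where M': "M = Suc M'" by (cases M) auto
    obtain a where a: "p = d + a" "a > 0" using d by (metis less_imp_add_positive)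
    have M2: "p * M = d + a + p * M'" unfolding M' using a(1) by simp
    have "N = r + p ^ f * (a + p * M')" unfolding N r M2 by (simp add: algebra_simps)
    moreover have "r < 2 * (p - a) * p ^ f" unfolding r by (rule less) (use a d in linarith)
    moreover have "a < p" using a d by linarith
    ultimately show ?thesis using I_set_iff_factorization[OF assms] a(2) by blast
  qed
qed

section \<open>Truncations of a sparse digit expansion\<close>

text \<open>By induction the lower terms stay below one unit of the top power, and a top digit of at
  most \<open>p - 1\<close> plus this unit is at most \<open>p\<close>. The bound \<open>f\<close>
  is generalized because the induction hypothesis is used at \<open>s (Suc j)\<close>.\<close>

lemma digit_sum_less:
  fixes p j :: nat and D s :: "nat \<Rightarrow> nat"
  assumes "p > 0" and "\<And>i. i \<in> {1..j} \<Longrightarrow> D i \<le> p - 1"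
    and "strict_mono_on {1..j} s" and "\<And>i. i \<in> {1..j} \<Longrightarrow> s i < f"
  shows "(\<Sum>i=1..j. D i * p ^ s i) < p ^ f"
  using assms(2-)
proof (induction j arbitrary: f)
  case 0
  then show ?case using assms(1) by simp
next
  case (Suc j)
  have "(\<Sum>i=1..j. D i * p ^ s i) < p ^ s (Suc j)"
  proof (rule Suc.IH)
    show "strict_mono_on {1..j} s" using Suc.prems(2) by (rule monotone_on_subset) auto
    show "s i < s (Suc j)" if "i \<in> {1..j}" for i
      using Suc.prems(2) that by (auto simp: strict_mono_on_def)
  qed (use Suc.prems in auto)
  then have "(\<Sum>i=1..Suc j. D i * p ^ s i) < (1 + D (Suc j)) * p ^ s (Suc j)" by simp
  also have "\<dots> \<le> p * p ^ s (Suc j)"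
    using Suc.prems(1)[of "Suc j"] assms(1) by (intro mult_right_mono) auto
  also have "\<dots> \<le> p ^ f"
    using Suc.prems(3)[of "Suc j"] assms(1) unfolding power_Suc[symmetric]
    by (intro power_increasing) auto
  finally show ?case .
qed

text \<open>The terms beyond \<open>j\<close> are divisible by \<open>p ^ f\<close>, and the others
  sum to less than \<open>p ^ f\<close>.\<close>

lemma digit_sum_mod_power:
  fixes p h j :: nat and D s :: "nat \<Rightarrow> nat"
  assumes "p > 0" and "\<And>i. i \<in> {1..h} \<Longrightarrow> D i \<le> p - 1"
    and "strict_mono_on {1..h} s" and "j \<le> h"
    and "\<And>i. i \<in> {1..j} \<Longrightarrow> s i < f" and "\<And>i. i \<in> {j<..h} \<Longrightarrow> f \<le> s i"
  shows "(\<Sum>i=1..h. D i * p ^ s i) mod p ^ f = (\<Sum>i=1..j. D i * p ^ s i)"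
proof -
  have "{1..h} = {1..j} \<union> {j<..h}" using assms(4) by auto
  then have "(\<Sum>i=1..h. D i * p ^ s i)
      = (\<Sum>i=1..j. D i * p ^ s i) + (\<Sum>i\<in>{j<..h}. D i * p ^ s i)"
    by (simp add: sum.union_disjoint disjoint_iff)
  moreover have "p ^ f dvd (\<Sum>i\<in>{j<..h}. D i * p ^ s i)"
    by (rule dvd_sum) (simp add: assms(6) dvd_mult le_imp_power_dvd)
  moreover have "(\<Sum>i=1..j. D i * p ^ s i) < p ^ f"
    by (rule digit_sum_less)
      (use assms monotone_on_subset[OF assms(3), of "{1..j}"] in auto)
  ultimately show ?thesis by (auto elim!: dvdE)
qed

text \<open>Locates a digit position \<open>f\<close> among the exponents: \<open>j\<close> counts
  those below \<open>f\<close>, with \<open>j = 0\<close> and \<open>j = h\<close> allowed.\<close>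

lemma strict_mono_on_threshold:
  fixes s :: "nat \<Rightarrow> nat"
  assumes "strict_mono_on {1..h} s"
  shows "\<exists>j\<le>h. (\<forall>i\<in>{1..j}. s i < f) \<and> (\<forall>i\<in>{j<..h}. f \<le> s i)"
  using assms
proof (induction h)
  case (Suc h)
  show ?case
  proof (cases "s (Suc h) < f")
    case True
    have "s i < f" if "i \<in> {1..Suc h}" for i
    proof (cases "i = Suc h")
      case i: False
      then have "s i < s (Suc h)" using Suc.prems that by (auto simp: strict_mono_on_def)
      then show ?thesis using True by simp
    qed (use True in simp)
    then show ?thesis by (intro exI[of _ "Suc h"]) auto
  next
    case False
    have "strict_mono_on {1..h} s" using Suc.prems by (rule monotone_on_subset) auto
    from Suc.IH[OF this] obtain j where "j \<le> h" "\<forall>i\<in>{1..j}. s i < f" "\<forall>i\<in>{j<..h}. f \<le> s i"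
      by blast
    with False show ?thesis by (intro exI[of _ j]) (auto simp: le_Suc_eq)
  qed
qed simp

section \<open>Matching the digit criterion with the six forms\<close>

theorem theorem5p7:
  fixes p N h r :: nat and D s :: "nat \<Rightarrow> nat"
  assumes "prime p" and "N \<ge> 2"
    and "N = (\<Sum>i=1..h. D i * p ^ s i)"
    and "\<And>i. i \<in> {1..h} \<Longrightarrow> 1 \<le> D i \<and> D i \<le> p - 1"
    and "strict_mono_on {1..h} s"
    and "1 \<le> r" and "r < N"
  shows "r \<in> I_set p N \<longleftrightarrow>
      (\<exists>d t. r = d * p ^ t \<and> t < s 1 \<and> 1 \<le> d \<and> d \<le> p - 1)
    \<or> (\<exists>d. r = d * p ^ s 1 \<and> 1 \<le> d \<and> d \<le> D 1 - 1)
    \<or> (\<exists>j. r = (\<Sum>i=1..j. D i * p ^ s i) \<and> 1 \<le> j \<and> j < h)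
    \<or> (\<exists>j d. r = (\<Sum>i=1..j. D i * p ^ s i) + d * p ^ s j \<and> 1 \<le> j \<and> j < h
          \<and> D j + 1 \<le> d \<and> d \<le> p - 1)
    \<or> (\<exists>j d t. r = (\<Sum>i=1..j. D i * p ^ s i) + d * p ^ t \<and> 1 \<le> j \<and> j < h
          \<and> s j < t \<and> t < s (j + 1) \<and> 1 \<le> d \<and> d \<le> p - 1)
    \<or> (\<exists>j d. r = (\<Sum>i=1..j. D i * p ^ s i) + d * p ^ s (j + 1) \<and> 1 \<le> j \<and> j < h
          \<and> 1 \<le> d \<and> d \<le> D (j + 1) - 1)"
proof -
  have p: "p > 1" using assms(1) by (rule prime_gt_1_nat)
  \<comment> \<open>Since \<open>P 0 = 0\<close>, the first two disjuncts are the fifth and sixth at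
    \<open>j = 0\<close>, with the lower bound on \<open>t\<close> dropped.\<close>
  define P where "P j = (\<Sum>i=1..j. D i * p ^ s i)" for j
  have P0: "P 0 = 0" and PS: "P (Suc j) = P j + D (Suc j) * p ^ s (Suc j)" for j
    by (simp_all add: P_def)
  have N: "N = P h" using assms(3) by (simp add: P_def)
  have h: "h \<ge> 1" using assms(2) N P0 by (cases h) auto
  have D: "1 \<le> D i" "D i \<le> p - 1" "D i < p" if "1 \<le> i" "i \<le> h" for i
    using assms(4)[of i] that p by auto
  have mono: "s i < s j" if "1 \<le> i" "i < j" "j \<le> h" for i j
    using assms(5) that by (auto simp: strict_mono_on_def)
  have mono_le: "s i \<le> s j" if "1 \<le> i" "i \<le> j" "j \<le> h" for i j
    using mono[of i j] that by (cases "i = j") auto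
  \<comment> \<open>The guards on \<open>lo\<close> and \<open>hi\<close> reflect that
    \<open>s\<close> is constrained only on \<open>{1..h}\<close>; by monotonicity the two
    neighbours of \<open>f\<close> suffice.\<close>
  have Nmod: "N mod p ^ f = P j"
    if j: "j \<le> h" and lo: "j \<noteq> 0 \<Longrightarrow> s j < f" and hi: "j < h \<Longrightarrow> f \<le> s (Suc j)" for j f
    unfolding N P_def
  proof (rule digit_sum_mod_power)
    show "s i < f" if "i \<in> {1..j}" for i using mono_le[of i j] lo that j by auto
    show "f \<le> s i" if "i \<in> {j<..h}" for i using mono_le[of "Suc j" i] hi that by auto
  qed (use p D assms(5) j in auto)
  have digit: "N div p ^ f mod p = c" if "N mod p ^ Suc f = N mod p ^ f + c * p ^ f" for f c
    using that p unfolding mod_power_Suc by simp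
  have digit_s: "N div p ^ s (Suc j) mod p = D (Suc j)" "N mod p ^ s (Suc j) = P j"
      "N mod p ^ Suc (s (Suc j)) = P (Suc j)" if "j < h" for j
  proof -
    show 1: "N mod p ^ s (Suc j) = P j" using that mono by (intro Nmod) auto
    show 2: "N mod p ^ Suc (s (Suc j)) = P (Suc j)"
      using that mono[of "Suc j" "Suc (Suc j)"] by (intro Nmod) auto
    show "N div p ^ s (Suc j) mod p = D (Suc j)" by (rule digit) (use 1 2 PS in simp)
  qed
  \<comment> \<open>Off the exponents, the truncations at \<open>f\<close> and \<open>Suc f\<close>
    coincide, so the digit between them is zero.\<close>
  have digit_0: "N div p ^ f mod p = 0" "N mod p ^ f = P j" "N mod p ^ Suc f = P j"
    if "j \<le> h" "j \<noteq> 0 \<Longrightarrow> s j < f" "j < h \<Longrightarrow> f < s (Suc j)" for j f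
  proof -
    show 1: "N mod p ^ f = P j" using that by (intro Nmod) auto
    show 2: "N mod p ^ Suc f = P j" using that by (intro Nmod) (auto simp: less_Suc_eq)
    show "N div p ^ f mod p = 0" by (rule digit) (use 1 2 in simp)
  qed
  note I = I_set_iff_digit[OF assms(1,7)]
  have I_less: "r \<in> I_set p N" if "q < N div p ^ f mod p" "r = N mod p ^ f + q * p ^ f" for q f
    using I that by blast
  have I_greater: "r \<in> I_set p N"
    if "N div p ^ f mod p < d" "d \<le> p - 1" "r = N mod p ^ Suc f + d * p ^ f" for d f
    using I that p by (metis One_nat_def Suc_pred' le_imp_less_Suc less_trans zero_less_one)
  show ?thesis
    unfolding P_def[symmetric]
  proof (rule iffI, goal_cases)
    case 1
    then obtain f where f: "(\<exists>q < N div p ^ f mod p. r = N mod p ^ f + q * p ^ f) \<or>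
         (\<exists>d. N div p ^ f mod p < d \<and> d < p \<and> r = N mod p ^ Suc f + d * p ^ f)"
      using I by blast
    obtain j where j: "j \<le> h" and lo: "\<forall>i\<in>{1..j}. s i < f" and hi: "\<forall>i\<in>{j<..h}. f \<le> s i"
      using strict_mono_on_threshold[OF assms(5)] by blast
    show ?case
    proof (cases "j < h \<and> f = s (Suc j)")
      case True
      note ds = digit_s[of j, OF conjunct1[OF True]]
      from f show ?thesis
      proof
        assume "\<exists>q < N div p ^ f mod p. r = N mod p ^ f + q * p ^ f"
        then obtain q where q: "q < D (Suc j)" "r = P j + q * p ^ s (Suc j)" using True ds by auto
        \<comment> \<open>These cases lead to the second, third and sixth disjuncts;
          \<open>j = 0\<close> with \<open>q = 0\<close> would give \<open>r = 0\<close>.\<close>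
        consider "j = 0" | "j \<noteq> 0" "q = 0" | "j \<noteq> 0" "q \<noteq> 0" by blast
        then show ?thesis
        proof cases
          case 1
          then have "q \<noteq> 0" using q P0 assms(6) by (cases q) auto
          then have "\<exists>d. r = d * p ^ s 1 \<and> 1 \<le> d \<and> d \<le> D 1 - 1"
            using q 1 P0 by (intro exI[of _ q]) auto
          then show ?thesis by blast
        next
          case 2
          then have "\<exists>j. r = P j \<and> 1 \<le> j \<and> j < h" using q True by (intro exI[of _ j]) auto
          then show ?thesis by blast
        next
          case 3
          then have "\<exists>j d. r = P j + d * p ^ s (j + 1) \<and> 1 \<le> j \<and> j < h \<and> 1 \<le> d \<and> d \<le> D (j + 1) - 1"
            using q True by (intro exI[of _ j] exI[of _ q]) auto
          then show ?thesis by blast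
        qed
      next
        assume "\<exists>d. N div p ^ f mod p < d \<and> d < p \<and> r = N mod p ^ Suc f + d * p ^ f"
        then obtain d where d: "D (Suc j) < d" "d < p" "r = P (Suc j) + d * p ^ s (Suc j)"
          using True ds by auto
        \<comment> \<open>Otherwise \<open>r\<close> would be at least
          \<open>P h = N\<close>.\<close>
        have "Suc j \<noteq> h" using d(3) assms(7) N by auto
        then have "\<exists>j d. r = P j + d * p ^ s j \<and> 1 \<le> j \<and> j < h \<and> D j + 1 \<le> d \<and> d \<le> p - 1"
          using d True by (intro exI[of _ "Suc j"] exI[of _ d]) auto
        then show ?thesis by blast
      qed
    next
      case False
      have lo': "j \<noteq> 0 \<Longrightarrow> s j < f" and hi': "j < h \<Longrightarrow> f < s (Suc j)"
        using lo hi False by (auto simp: le_less)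
      note d0 = digit_0[OF j lo' hi']
      \<comment> \<open>No \<open>q\<close> lies below the digit 0, so only the alternative with
        \<open>d\<close> remains, and there \<open>d\<close> is merely positive.\<close>
      obtain d where d: "0 < d" "d < p" "r = P j + d * p ^ f" using f d0 by auto
      have jh: "j < h" using d(3) assms(7) N j by (cases "j = h") auto
      show ?thesis
      proof (cases "j = 0")
        case True
        then have "\<exists>d t. r = d * p ^ t \<and> t < s 1 \<and> 1 \<le> d \<and> d \<le> p - 1"
          using d hi' jh P0 by (intro exI[of _ d] exI[of _ f]) auto
        then show ?thesis by blast
      next
        case False
        then have "\<exists>j d t. r = P j + d * p ^ t \<and> 1 \<le> j \<and> j < h
            \<and> s j < t \<and> t < s (j + 1) \<and> 1 \<le> d \<and> d \<le> p - 1"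
          using d lo' hi' jh by (intro exI[of _ j] exI[of _ d] exI[of _ f]) auto
        then show ?thesis by blast
      qed
    qed
  next
    case 2
    then show ?case
    proof (elim disjE exE conjE, goal_cases)
      case (1 d t)
      then show ?case using digit_0[of 0 t] P0 by (intro I_greater[of t d]) auto
    next
      case (2 d)
      then show ?case using digit_s[of 0] h P0 by (intro I_less[of d "s 1"]) auto
    next
      case (3 j)
      \<comment> \<open>A bare partial sum is the case \<open>q = 0\<close> at the next exponent,
        whose digit is at least 1.\<close>
      then show ?case using digit_s[of j] D[of "Suc j"] by (intro I_less[of 0 "s (Suc j)"]) auto
    next
      case (4 j d)
      \<comment> \<open>The extra term sits at the last exponent \<open>s j\<close> of the partial
        sum itself, hence the shift to \<open>j - 1\<close>.\<close>
      then show ?case using digit_s[of "j - 1"] by (intro I_greater[of "s j" d]) auto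
    next
      case (5 j d t)
      then show ?case using digit_0[of j t] by (intro I_greater[of t d]) auto
    next
      case (6 j d)
      then show ?case using digit_s[of j] by (intro I_less[of d "s (Suc j)"]) auto
    qed
  qed
qed

end
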